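(* If $MA_{\aleph_1}$ holds, then the space $\sigma(2^{\omega_1})=\{x\in 2^{\omega_1}:|x^{-1}(1)|<\omega\}$, as a subspace of the Cantor cube $2^{\omega_1}$, is discretely discretely generated.
   Context: A space $X$ is discretely discretely generated (DDG) if for every set $A\subseteq X$ and every discrete set $D\subseteq\overline{A}$ there is a discrete set $E\subseteq A$ with $D\subseteq\overline{E}$. $MA_{\aleph_1}$ is Martin's Axiom for ccc posets and $\aleph_1$ dense sets. *)

theory Defs
  imports "HOL-Analysis.Analysis"
begin

definition discrete_in :: "'a topology \<Rightarrow> 'a set \<Rightarrow> bool" where
  "discrete_in X D \<longleftrightarrow> D \<subseteq> topspace X \<and>
     (\<forall>d\<in>D. \<exists>U. openin X U \<and> U \<inter> D = {d})"

definition DDG :: "'a topology \<Rightarrow> bool" where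
  "DDG X \<longleftrightarrow> (\<forall>A D. A \<subseteq> topspace X \<and> discrete_in X D \<and> D \<subseteq> X closure_of A \<longrightarrow>
      (\<exists>E. E \<subseteq> A \<and> discrete_in X E \<and> D \<subseteq> X closure_of E))"

definition cantor_cube :: "'i set \<Rightarrow> ('i \<Rightarrow> nat) topology" where
  "cantor_cube I = product_topology (\<lambda>_. discrete_topology {0, 1}) I"

definition sigma_cantor :: "'i set \<Rightarrow> ('i \<Rightarrow> nat) set" where
  "sigma_cantor I = {x \<in> topspace (cantor_cube I). finite {i \<in> I. x i = 1}}"

definition aleph1 :: "nat set rel" where
  "aleph1 = cardSuc (card_of (UNIV :: nat set))"

definition poset_on :: "'p set \<Rightarrow> ('p \<Rightarrow> 'p \<Rightarrow> bool) \<Rightarrow> bool" where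
  "poset_on P le \<longleftrightarrow> (\<forall>p\<in>P. le p p) \<and>
     (\<forall>p\<in>P. \<forall>q\<in>P. \<forall>r\<in>P. le p q \<and> le q r \<longrightarrow> le p r) \<and>
     (\<forall>p\<in>P. \<forall>q\<in>P. le p q \<and> le q p \<longrightarrow> p = q)"

definition compatible :: "'p set \<Rightarrow> ('p \<Rightarrow> 'p \<Rightarrow> bool) \<Rightarrow> 'p \<Rightarrow> 'p \<Rightarrow> bool" where
  "compatible P le p q \<longleftrightarrow> (\<exists>r\<in>P. le r p \<and> le r q)"

definition antichain :: "'p set \<Rightarrow> ('p \<Rightarrow> 'p \<Rightarrow> bool) \<Rightarrow> 'p set \<Rightarrow> bool" where
  "antichain P le A \<longleftrightarrow> A \<subseteq> P \<and>
     (\<forall>p\<in>A. \<forall>q\<in>A. p \<noteq> q \<longrightarrow> \<not> compatible P le p q)"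

definition ccc :: "'p set \<Rightarrow> ('p \<Rightarrow> 'p \<Rightarrow> bool) \<Rightarrow> bool" where
  "ccc P le \<longleftrightarrow> (\<forall>A. antichain P le A \<longrightarrow> countable A)"

definition dense_in :: "'p set \<Rightarrow> ('p \<Rightarrow> 'p \<Rightarrow> bool) \<Rightarrow> 'p set \<Rightarrow> bool" where
  "dense_in P le D \<longleftrightarrow> D \<subseteq> P \<and> (\<forall>p\<in>P. \<exists>q\<in>D. le q p)"

definition filter_in :: "'p set \<Rightarrow> ('p \<Rightarrow> 'p \<Rightarrow> bool) \<Rightarrow> 'p set \<Rightarrow> bool" where
  "filter_in P le G \<longleftrightarrow> G \<subseteq> P \<and> G \<noteq> {} \<and>
     (\<forall>p\<in>G. \<forall>q\<in>P. le p q \<longrightarrow> q \<in> G) \<and>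
     (\<forall>p\<in>G. \<forall>q\<in>G. \<exists>r\<in>G. le r p \<and> le r q)"

text \<open>MA for ccc posets whose carrier lies in the type 'p and families of at most
  aleph_1 dense sets.  Taking 'p to contain a set of size aleph_1 this is
  equivalent to MA(aleph_1) (which may be restricted to posets of size at most aleph_1).\<close>
definition MA_aleph1 :: "'p itself \<Rightarrow> bool" where
  "MA_aleph1 _ \<longleftrightarrow> (\<forall>(P :: 'p set) le \<D>.
     P \<noteq> {} \<and> poset_on P le \<and> ccc P le \<and> ordLeq3 (card_of \<D>) aleph1 \<and>
     (\<forall>D\<in>\<D>. dense_in P le D) \<longrightarrow>
     (\<exists>G. filter_in P le G \<and> (\<forall>D\<in>\<D>. G \<inter> D \<noteq> {})))"

end

theory Submission
  imports Defs
begin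

text \<open>
  Identify points of the space with finite subsets of \<open>I\<close>; a basic neighbourhood of \<open>x\<close> consists of
  the \<open>y\<close> with \<open>y \<inter> F = x \<inter> F\<close>. Discard the points of \<open>A\<close> in \<open>cl D - D\<close>, leaving \<open>B\<close> with
  \<open>D \<subseteq> cl B\<close>. Fix for each \<open>b \<in> B\<close> one finite \<open>G b \<supseteq> b\<close> whose neighbourhood of \<open>b\<close> contains
  no other point of \<open>D\<close>, and no other point of \<open>B\<close> if \<open>b\<close> is isolated in \<open>B\<close>. Force with the finite
  subsets of \<open>B\<close> in which these neighbourhoods isolate every point. As \<open>a \<inter> G b = b\<close> forces \<open>b \<subseteq> a\<close>, a
  Delta-system argument gives ccc. A point of \<open>D\<close> that is isolated in \<open>B\<close> can always be added to a
  condition; any other \<open>d \<in> D\<close> is approximated by points of \<open>B - {d}\<close> close enough to \<open>d\<close>. So the union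
  of a sufficiently generic filter is the required discrete set.
\<close>

section \<open>The Delta-system lemma for uncountable families of finite sets\<close>

text \<open>Induction on the common size. If one point lies in uncountably many members, it is
  removed from them and later put back into the root. Otherwise a maximal pairwise disjoint
  subfamily is already uncountable, with empty root.\<close>

lemma delta_system_card:
  fixes \<A> :: "'a set set"
  assumes "uncountable \<A>" "\<And>p. p \<in> \<A> \<Longrightarrow> finite p \<and> card p = n"
  shows "\<exists>\<B> R. \<B> \<subseteq> \<A> \<and> uncountable \<B> \<and> (\<forall>p\<in>\<B>. \<forall>q\<in>\<B>. p \<noteq> q \<longrightarrow> p \<inter> q = R)"
  using assms
proof (induction n arbitrary: \<A>)
  case 0
  then have "\<A> \<subseteq> {{}}" by fastforce
  then have "countable \<A>" by (simp add: countable_subset)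
  with 0 show ?case by simp
next
  case (Suc n)
  show ?case
  proof (cases "\<exists>x. uncountable {p\<in>\<A>. x \<in> p}")
    case True
    then obtain x where x: "uncountable {p\<in>\<A>. x \<in> p}" by blast
    let ?f = "\<lambda>p. p - {x}"
    have "inj_on ?f {p\<in>\<A>. x \<in> p}"
      by (auto simp: inj_on_def)
    with x have unc: "uncountable (?f ` {p\<in>\<A>. x \<in> p})"
      using countable_image_inj_on by blast
    have fin: "finite p \<and> card p = n" if "p \<in> ?f ` {p\<in>\<A>. x \<in> p}" for p
      using that Suc.prems(2) by auto
    obtain \<B> R where B: "\<B> \<subseteq> ?f ` {p\<in>\<A>. x \<in> p}" "uncountable \<B>"
      "\<forall>p\<in>\<B>. \<forall>q\<in>\<B>. p \<noteq> q \<longrightarrow> p \<inter> q = R"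
      using Suc.IH[OF unc] fin by force
    have inj: "inj_on (insert x) \<B>"
      using B(1) by (auto simp: inj_on_def)
    have "insert x ` \<B> \<subseteq> \<A>"
      using B(1) by (auto simp: insert_absorb)
    moreover have "uncountable (insert x ` \<B>)"
      using B(2) inj countable_image_inj_on by blast
    moreover have "p \<inter> q = insert x R" if "p \<in> insert x ` \<B>" "q \<in> insert x ` \<B>" "p \<noteq> q" for p q
      using that B(3) by (auto simp: Int_insert_left)
    ultimately show ?thesis
      by (intro exI[of _ "insert x ` \<B>"] exI[of _ "insert x R"] conjI ballI impI)
  next
    case False
    \<comment> \<open>Zorn's lemma supplies the maximal disjoint subfamily.\<close>
    define \<F> where "\<F> = {\<B>. \<B> \<subseteq> \<A> \<and> pairwise disjnt \<B>}"
    have "\<Union>C \<in> \<F>" if "subset.chain \<F> C" for C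
    proof -
      have C: "C \<subseteq> \<F>" "chain\<^sub>\<subseteq> C"
        using that by (auto simp: subset.chain_def chain_subset_def)
      have "pairwise disjnt (\<Union>C)"
        by (rule pairwise_chain_Union[OF _ C(2)]) (use C(1) in \<open>auto simp: \<F>_def\<close>)
      then show ?thesis using C(1) by (auto simp: \<F>_def)
    qed
    from subset_Zorn'[OF this] obtain \<B> where B: "\<B> \<in> \<F>"
      and max: "\<And>\<C>. \<C> \<in> \<F> \<Longrightarrow> \<B> \<subseteq> \<C> \<Longrightarrow> \<C> = \<B>"
      by blast
    have BA: "\<B> \<subseteq> \<A>" and dis: "pairwise disjnt \<B>" using B by (auto simp: \<F>_def)
    have "uncountable \<B>"
    proof
      assume "countable \<B>"
      then have "countable (\<Union>\<B>)"
        using countable_UN[of \<B> "\<lambda>p. p"] BA Suc.prems(2) by (auto intro: countable_finite)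
      \<comment> \<open>Each point lies in only countably many members, so only countably many
        members meet the countable set \<open>\<Union>\<B>\<close>. A member missing it would extend
        \<open>\<B>\<close>.\<close>
      then have "countable (\<Union>x\<in>\<Union>\<B>. {p\<in>\<A>. x \<in> p})"
        using False by (intro countable_UN) auto
      then have "\<not> \<A> \<subseteq> (\<Union>x\<in>\<Union>\<B>. {p\<in>\<A>. x \<in> p})"
        using Suc.prems(1) countable_subset by blast
      then obtain p where p: "p \<in> \<A>" and "p \<notin> (\<Union>x\<in>\<Union>\<B>. {p\<in>\<A>. x \<in> p})" 
        unfolding subset_iff by auto
      then have d: "p \<inter> \<Union>\<B> = {}" by blast
      \<comment> \<open>The size \<open>Suc n\<close> matters here: an empty \<open>p\<close> would
        be disjoint from \<open>\<Union>\<B>\<close> even while belonging to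
        \<open>\<B>\<close>.\<close>
      have "p \<noteq> {}" using Suc.prems(2)[OF p] by auto
      with d have "p \<notin> \<B>" by blast
      moreover have "insert p \<B> \<in> \<F>"
        using p BA dis d unfolding \<F>_def
        by (auto simp: pairwise_insert disjnt_def)
      ultimately show False using max[of "insert p \<B>"] by blast
    qed
    then show ?thesis using BA dis
      by (intro exI[of _ \<B>] exI[of _ "{}"]) (auto simp: pairwise_def disjnt_def)
  qed
qed

text \<open>Some size occurs uncountably often, since there are only countably many sizes.\<close>

lemma delta_system:
  fixes \<A> :: "'a set set"
  assumes unc: "uncountable \<A>" and fin: "\<And>p. p \<in> \<A> \<Longrightarrow> finite p"
  obtains \<B> R where "\<B> \<subseteq> \<A>" "uncountable \<B>"
    "\<And>p q. p \<in> \<B> \<Longrightarrow> q \<in> \<B> \<Longrightarrow> p \<noteq> q \<Longrightarrow> p \<inter> q = R"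
proof -
  have "\<A> = (\<Union>n. {p\<in>\<A>. card p = n})" by blast
  with unc have "\<not> (\<forall>n. countable {p\<in>\<A>. card p = n})"
    using countable_UN[of UNIV "\<lambda>n. {p\<in>\<A>. card p = n}"] by auto
  then obtain n where "uncountable {p\<in>\<A>. card p = n}" by blast
  from delta_system_card[OF this, of n] fin
  obtain \<B> R where B: "\<B> \<subseteq> {p\<in>\<A>. card p = n}" "uncountable \<B>"
    "\<forall>p\<in>\<B>. \<forall>q\<in>\<B>. p \<noteq> q \<longrightarrow> p \<inter> q = R"
    by blast
  show ?thesis
  proof (rule that)
    show "\<B> \<subseteq> \<A>" "uncountable \<B>" using B by auto
    show "p \<inter> q = R" if "p \<in> \<B>" "q \<in> \<B>" "p \<noteq> q" for p q using B(3) that by simp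
  qed
qed

section \<open>Counting finite subsets, and moving Martin's Axiom to other types\<close>

text \<open>Subsets of size \<open>Suc n\<close> are images of pairs of a point and a subset of size
  \<open>n\<close>, and an infinite cardinal absorbs both this product and the countable union over
  sizes.\<close>

lemma card_of_Fpow_ordLeq:
  fixes S :: "'a set"
  assumes S: "infinite S"
  shows "ordLeq3 (card_of (Fpow S)) (card_of S)"
proof -
  have "ordLeq3 (card_of {X \<in> Fpow S. card X = n}) (card_of S)" for n
  proof (induction n)
    case 0
    have "{X \<in> Fpow S. card X = 0} \<subseteq> {{}}" by (auto simp: Fpow_def)
    moreover have "ordLeq3 (card_of {{} :: 'a set}) (card_of S)"
      using S by (intro card_of_singl_ordLeq) auto
    ultimately show ?case by (meson card_of_mono1 ordLeq_transitive)
  next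
    case (Suc n)
    let ?T = "S \<times> {X \<in> Fpow S. card X = n}"
    have "{X \<in> Fpow S. card X = Suc n} \<subseteq> (\<lambda>(x, X). insert x X) ` ?T"
    proof
      fix X assume "X \<in> {X \<in> Fpow S. card X = Suc n}"
      then have X: "X \<subseteq> S" "finite X" "card X = Suc n" by (auto simp: Fpow_def)
      then obtain x where x: "x \<in> X" by fastforce
      then have "(x, X - {x}) \<in> ?T" using X by (auto simp: Fpow_def)
      moreover have "X = (\<lambda>(x, X). insert x X) (x, X - {x})" using x by auto
      ultimately show "X \<in> (\<lambda>(x, X). insert x X) ` ?T" by (rule rev_image_eqI)
    qed
    then have "ordLeq3 (card_of {X \<in> Fpow S. card X = Suc n}) (card_of ?T)"
      by (meson card_of_image card_of_mono1 ordLeq_transitive)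
    moreover have "ordLeq3 (card_of ?T) (card_of S)"
      using S Suc.IH
      by (intro card_of_Times_ordLeq_infinite_Field)
        (simp_all add: Field_card_of card_of_refl ordIso_imp_ordLeq card_of_card_order_on)
    ultimately show ?case by (rule ordLeq_transitive)
  qed
  then have "ordLeq3 (card_of (\<Union>n. {X \<in> Fpow S. card X = n})) (card_of S)"
    using S by (intro card_of_UNION_ordLeq_infinite) (auto simp: infinite_iff_card_of_nat[symmetric])
  moreover have "Fpow S = (\<Union>n. {X \<in> Fpow S. card X = n})" by blast
  ultimately show ?thesis by simp
qed

text \<open>The axiom is assumed only for carriers inside \<open>'i\<close>, whereas the forcing
  conditions used later are sets of sets over \<open>'i\<close>. An injection of the carrier into
  \<open>'i\<close> carries the order, chain condition and dense sets over, and the generic filter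
  back.\<close>

lemma MA_aleph1_transfer:
  fixes P :: "'q set"
  assumes MA: "MA_aleph1 TYPE('i)" and card: "ordLeq3 (card_of P) (card_of (UNIV :: 'i set))"
    and ne: "P \<noteq> {}" and po: "poset_on P le" and ccc: "ccc P le"
    and c\<D>: "ordLeq3 (card_of \<D>) aleph1" and dense: "\<And>D. D \<in> \<D> \<Longrightarrow> dense_in P le D"
  obtains G where "filter_in P le G" "\<And>D. D \<in> \<D> \<Longrightarrow> G \<inter> D \<noteq> {}"
proof -
  obtain f :: "'q \<Rightarrow> 'i" where f: "inj_on f P"
    using card card_of_ordLeq[of P "UNIV :: 'i set"] by blast
  define g where "g = inv_into P f"
  have gf [simp]: "g (f p) = p" if "p \<in> P" for p
    using f that by (simp add: g_def)
  have gP: "g x \<in> P" "f (g x) = x" if "x \<in> f ` P" for x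
    using that by auto
  define le' where "le' = (\<lambda>x y. le (g x) (g y))"
  have "poset_on (f ` P) le'"
    unfolding poset_on_def
  proof (intro conjI ballI impI)
    show "le' x x" if "x \<in> f ` P" for x
      using po gP(1)[OF that] unfolding poset_on_def le'_def by blast
    show "le' x z" if "x \<in> f ` P" "y \<in> f ` P" "z \<in> f ` P" "le' x y \<and> le' y z" for x y z
      using po gP(1)[OF that(1)] gP(1)[OF that(2)] gP(1)[OF that(3)] that(4)
      unfolding poset_on_def le'_def by blast
    show "x = y" if "x \<in> f ` P" "y \<in> f ` P" "le' x y \<and> le' y x" for x y
    proof -
      have "g x = g y"
        using po gP(1)[OF that(1)] gP(1)[OF that(2)] that(3)
        unfolding poset_on_def le'_def by blast
      then show ?thesis using gP(2)[OF that(1)] gP(2)[OF that(2)] by metis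
    qed
  qed
  moreover have "ccc (f ` P) le'"
    unfolding ccc_def
  proof (intro allI impI)
    fix A assume A: "antichain (f ` P) le' A"
    then have AP: "A \<subseteq> f ` P" by (simp add: antichain_def)
    have "antichain P le (g ` A)"
      unfolding antichain_def
    proof (intro conjI ballI impI)
      show "g ` A \<subseteq> P" using AP gP(1) by blast
      fix p q assume "p \<in> g ` A" "q \<in> g ` A" "p \<noteq> q"
      then obtain x y where xy: "x \<in> A" "y \<in> A" "x \<noteq> y" "p = g x" "q = g y" by blast
      show "\<not> compatible P le p q"
      proof
        assume "compatible P le p q"
        then obtain r where r: "r \<in> P" "le r p" "le r q" unfolding compatible_def by blast
        then have "le' (f r) x" "le' (f r) y" using xy by (simp_all add: le'_def)
        then have "compatible (f ` P) le' x y" using r(1) unfolding compatible_def by blast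
        with A xy show False unfolding antichain_def by blast
      qed
    qed
    then have "countable (f ` g ` A)"
      using ccc by (auto simp: ccc_def)
    moreover have "f ` g ` A = A"
      using AP gP(2) by (force simp: image_image)
    ultimately show "countable A" by simp
  qed
  moreover have "ordLeq3 (card_of ((`) f ` \<D>)) aleph1"
    using card_of_image c\<D> ordLeq_transitive by blast
  moreover have "dense_in (f ` P) le' (f ` D)" if "D \<in> \<D>" for D
    unfolding dense_in_def
  proof (intro conjI ballI)
    have D: "D \<subseteq> P" "\<forall>p\<in>P. \<exists>q\<in>D. le q p" using dense[OF that] by (auto simp: dense_in_def)
    show "f ` D \<subseteq> f ` P" using D(1) by blast
    fix x assume "x \<in> f ` P"
    then obtain q where q: "q \<in> D" "le q (g x)" using gP(1) D(2) by blast
    moreover have "g (f q) = q" using D(1) q by auto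
    ultimately have "le' (f q) x" by (simp add: le'_def)
    then show "\<exists>y\<in>f ` D. le' y x" using q(1) by blast
  qed
  then have "\<forall>D\<in>(`) f ` \<D>. dense_in (f ` P) le' D" by blast
  ultimately obtain G where G: "filter_in (f ` P) le' G" "\<forall>D\<in>(`) f ` \<D>. G \<inter> D \<noteq> {}"
    using MA[unfolded MA_aleph1_def, rule_format, of "f ` P" le' "(`) f ` \<D>"] ne by blast
  define H where "H = {p\<in>P. f p \<in> G}"
  have GP: "G \<subseteq> f ` P" using G(1) by (simp add: filter_in_def)
  then have H: "H \<subseteq> P" "G = f ` H" by (auto simp: H_def)
  have "filter_in P le H"
    unfolding filter_in_def
  proof (intro conjI ballI impI)
    show "H \<subseteq> P" by (rule H)
    show "H \<noteq> {}" using G(1) H(2) by (auto simp: filter_in_def)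
    show "q \<in> H" if "p \<in> H" "q \<in> P" "le p q" for p q
    proof -
      have "le' (f p) (f q)" using that H(1) by (auto simp: le'_def)
      moreover have "f p \<in> G" "f q \<in> f ` P" using that by (auto simp: H_def)
      ultimately have "f q \<in> G" using G(1) unfolding filter_in_def by blast
      then show ?thesis using that(2) by (simp add: H_def)
    qed
    show "\<exists>r\<in>H. le r p \<and> le r q" if "p \<in> H" "q \<in> H" for p q
    proof -
      have "f p \<in> G" "f q \<in> G" using that by (auto simp: H_def)
      moreover have "\<forall>x\<in>G. \<forall>y\<in>G. \<exists>z\<in>G. le' z x \<and> le' z y"
        using G(1) by (simp add: filter_in_def)
      ultimately obtain x where x: "x \<in> G" "le' x (f p)" "le' x (f q)" by blast
      then obtain r where r: "r \<in> H" "x = f r" using H(2) by blast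
      moreover have "g (f r) = r" "g (f p) = p" "g (f q) = q" using that r H(1) by auto
      ultimately show ?thesis using x by (auto simp: le'_def)
    qed
  qed
  moreover have "H \<inter> D \<noteq> {}" if "D \<in> \<D>" for D
  proof -
    have "f ` H \<inter> f ` D \<noteq> {}" using G(2) that by (simp add: H(2))
    then show ?thesis
      using inj_on_image_Int[OF f H(1), of D] dense[OF that] by (auto simp: dense_in_def)
  qed
  ultimately show ?thesis using that by blast
qed

section \<open>The forcing conditions and their countable chain condition\<close>

text \<open>\<open>G b\<close> is the window through which \<open>b\<close> is observed. When
  \<open>b \<subseteq> G b\<close>, the equation \<open>a \<inter> G b = b\<close> says that
  \<open>a\<close> lies in the neighbourhood of \<open>b\<close> given by this window.\<close>

definition isolating :: "('i set \<Rightarrow> 'i set) \<Rightarrow> 'i set set \<Rightarrow> bool" where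
  "isolating G p \<longleftrightarrow> (\<forall>a\<in>p. \<forall>b\<in>p. a \<inter> G b = b \<longrightarrow> a = b)"

text \<open>If \<open>a\<close> and \<open>b\<close> come from different conditions and
  \<open>a \<inter> G b = b\<close>, then \<open>b \<subseteq> a \<subseteq> G a\<close> and
  \<open>b \<subseteq> G b\<close>. In a Delta system this confines \<open>b\<close> to the finite
  set of coordinates in the root, which spoils only few conditions; any two of the others have an
  isolating union.\<close>

lemma ccc_isolating:
  fixes G :: "'a set \<Rightarrow> 'a set"
  assumes G: "\<And>b. b \<in> B \<Longrightarrow> finite (G b) \<and> b \<subseteq> G b"
  shows "ccc {p \<in> Fpow B. isolating G p} (\<lambda>p q. q \<subseteq> p)"
  unfolding ccc_def
proof (intro allI impI, rule ccontr)
  fix A assume anti: "antichain {p \<in> Fpow B. isolating G p} (\<lambda>p q. q \<subseteq> p) A"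
    and unc: "uncountable A"
  have A: "p \<subseteq> B" "finite p" "isolating G p" if "p \<in> A" for p
    using anti that by (auto simp: antichain_def Fpow_def)
  \<comment> \<open>The disjoint sum lets a single Delta system control both the members of a
    condition and the coordinates of its windows.\<close>
  define T where "T p = p <+> \<Union>(G ` p)" for p
  have inj: "inj_on T A" by (auto simp: inj_on_def T_def)
  have uncT: "uncountable (T ` A)" using unc inj countable_image_inj_on by blast
  have finT: "finite (T p)" if "p \<in> A" for p
    using A[OF that] G by (auto simp: T_def)
  obtain \<B> R where B: "\<B> \<subseteq> T ` A" "uncountable \<B>"
    and R: "\<And>p q. p \<in> \<B> \<Longrightarrow> q \<in> \<B> \<Longrightarrow> p \<noteq> q \<Longrightarrow> p \<inter> q = R"
    by (rule delta_system[OF uncT]) (use finT in blast)+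
  define C where "C = {p\<in>A. T p \<in> \<B>}"
  have C: "T ` C = \<B>" using B(1) by (auto simp: C_def)
  then have uncC: "uncountable C" using B(2) by auto
  have RC: "T p \<inter> T q = R" if "p \<in> C" "q \<in> C" "p \<noteq> q" for p q
    using that inj by (intro R) (auto simp: C_def inj_on_def)
  define S where "S = {i. Inr i \<in> R}"
  \<comment> \<open>The conditions that might fail to amalgamate: some member outside the root uses
    only root coordinates.\<close>
  define bad where "bad = {p\<in>C. \<exists>b\<in>p. Inl b \<notin> R \<and> b \<subseteq> S}"
  have "finite R"
  proof -
    obtain p where p: "p \<in> C" using uncC by fastforce
    obtain q where "q \<in> C" "p \<noteq> q"
      using uncC by (metis countable_empty countable_insert singleton_iff subsetI countable_subset)
    then have "R \<subseteq> T p" using RC p by blast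
    then show ?thesis using finT p finite_subset by (auto simp: C_def)
  qed
  moreover have "Inr ` S \<subseteq> R" by (auto simp: S_def)
  ultimately have "finite (Inr ` S :: ('a set + 'a) set)" using finite_subset by blast
  then have finS: "finite S" by (rule finite_imageD) simp
  have "countable bad"
  proof -
    \<comment> \<open>Members outside the root are never shared, so choosing an offending member
      from each bad condition is injective into the finite set \<open>Pow S\<close>.\<close>
    obtain h where h: "\<And>p. p \<in> bad \<Longrightarrow> h p \<in> p \<and> Inl (h p) \<notin> R \<and> h p \<subseteq> S"
      using bchoice[of bad "\<lambda>p b. b \<in> p \<and> Inl b \<notin> R \<and> b \<subseteq> S"] unfolding bad_def by auto
    have "inj_on h bad"
    proof (rule inj_onI, rule ccontr)
      fix p q assume pq: "p \<in> bad" "q \<in> bad" "h p = h q" "p \<noteq> q"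
      then have "T p \<inter> T q = R" by (intro RC) (auto simp: bad_def)
      moreover have "Inl (h p) \<in> T p \<inter> T q" using h[OF pq(1)] h[OF pq(2)] pq(3)
        by (auto simp: T_def)
      ultimately show False using h[OF pq(1)] by blast
    qed
    moreover have "h ` bad \<subseteq> Pow S" using h by blast
    ultimately show ?thesis
      using finS by (metis countable_finite finite_Pow_iff finite_imageD finite_subset)
  qed
  then have "uncountable (C - bad)" using uncC by (metis countable_Un_iff Un_Diff_cancel Un_commute)
  then obtain p q where pq: "p \<in> C - bad" "q \<in> C - bad" "p \<noteq> q"
    by (metis countable_empty countable_insert singleton_iff subsetI countable_subset)
  have pqA: "p \<in> A" "q \<in> A" using pq by (auto simp: C_def)
  have key: "a = b" if "p \<in> C - bad" "q \<in> C - bad" "p \<noteq> q" "a \<in> p" "b \<in> q" "a \<inter> G b = b" for p q a b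
  proof -
    have pq: "p \<in> A" "q \<in> A" using that by (auto simp: C_def)
    have eq: "T p \<inter> T q = R" using RC that by blast
    show ?thesis
    \<comment> \<open>A root member \<open>b\<close> already belongs to \<open>p\<close>, where
      isolation is known. A member outside the root would make \<open>q\<close> bad.\<close>
    proof (cases "Inl b \<in> R")
      case True
      then have "b \<in> p" using eq by (auto simp: T_def)
      then show ?thesis using A(3)[OF pq(1)] that unfolding isolating_def by blast
    next
      case False
      have "b \<subseteq> a" "a \<subseteq> G a" "b \<subseteq> G b"
        using that(6) G A(1) pq that(4,5) by blast+
      then have "Inr i \<in> T p \<inter> T q" if "i \<in> b" for i
        using \<open>a \<in> p\<close> \<open>b \<in> q\<close> that by (auto simp: T_def)
      then have "b \<subseteq> S" using eq by (auto simp: S_def)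
      then have "q \<in> bad" using False that by (auto simp: bad_def)
      with that show ?thesis by blast
    qed
  qed
  have "isolating G (p \<union> q)"
    unfolding isolating_def
  proof (intro ballI impI)
    fix a b assume ab: "a \<in> p \<union> q" "b \<in> p \<union> q" "a \<inter> G b = b"
    consider "a \<in> p" "b \<in> p" | "a \<in> q" "b \<in> q" | "a \<in> p" "b \<in> q" | "a \<in> q" "b \<in> p"
      using ab by blast
    then show "a = b"
    proof cases
      case 1
      then show ?thesis using A(3)[OF pqA(1)] ab(3) by (simp add: isolating_def)
    next
      case 2
      then show ?thesis using A(3)[OF pqA(2)] ab(3) by (simp add: isolating_def)
    next
      case 3
      then show ?thesis using key[OF pq] ab(3) by simp
    next
      case 4
      then show ?thesis using key[OF pq(2,1) pq(3)[symmetric]] ab(3) by simp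
    qed
  qed
  then have "compatible {p \<in> Fpow B. isolating G p} (\<lambda>p q. q \<subseteq> p) p q"
    using A[OF pqA(1)] A[OF pqA(2)] unfolding compatible_def
    by (intro bexI[of _ "p \<union> q"]) (auto simp: Fpow_def)
  then show False using anti pqA pq(3) by (auto simp: antichain_def)
qed

section \<open>The combinatorial form of the theorem, for finite subsets of \<open>I\<close>\<close>

definition fin_discrete :: "'i set \<Rightarrow> 'i set set \<Rightarrow> bool" where
  "fin_discrete I D \<longleftrightarrow> (\<forall>d\<in>D. \<exists>F\<in>Fpow I. \<forall>e\<in>D. e \<inter> F = d \<inter> F \<longrightarrow> e = d)"

definition fin_closure :: "'i set \<Rightarrow> 'i set set \<Rightarrow> 'i set set" where
  "fin_closure I A = {d. \<forall>F\<in>Fpow I. \<exists>a\<in>A. a \<inter> F = d \<inter> F}"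

lemma Fpow_Un: "x \<in> Fpow I \<Longrightarrow> y \<in> Fpow I \<Longrightarrow> x \<union> y \<in> Fpow I"
  by (auto simp: Fpow_def)

lemma Int_cut: "x \<inter> (F \<union> F') = y \<inter> (F \<union> F') \<longleftrightarrow> x \<inter> F = y \<inter> F \<and> x \<inter> F' = y \<inter> F'"
  by blast

lemma fin_DDG:
  fixes I :: "'i set"
  assumes I: "ordIso2 (card_of I) aleph1" and MA: "MA_aleph1 TYPE('i)"
    and A: "A \<subseteq> Fpow I" and D: "D \<subseteq> Fpow I" and disc: "fin_discrete I D" and DA: "D \<subseteq> fin_closure I A"
  obtains E where "E \<subseteq> A" "fin_discrete I E" "D \<subseteq> fin_closure I E"
proof -
  \<comment> \<open>The condition says that \<open>a\<close> is not in the closure of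
    \<open>D - {a}\<close>. It holds for every \<open>a \<in> A \<inter> D\<close> by discreteness,
    and for other points of \<open>A\<close> exactly when they are outside the closure of
    \<open>D\<close>.\<close>
  define B where "B = {a\<in>A. \<exists>F\<in>Fpow I. \<forall>d\<in>D. d \<inter> F = a \<inter> F \<longrightarrow> d = a}"
  have BI: "B \<subseteq> Fpow I" using A by (auto simp: B_def)
  have DB: "D \<subseteq> fin_closure I B"
    unfolding fin_closure_def
  proof (intro subsetI CollectI ballI)
    fix d F assume d: "d \<in> D" and F: "F \<in> Fpow I"
    obtain F' where F': "F' \<in> Fpow I" "\<forall>e\<in>D. e \<inter> F' = d \<inter> F' \<longrightarrow> e = d"
      using disc d unfolding fin_discrete_def by blast
    have "F \<union> F' \<in> Fpow I" using F F' by (simp add: Fpow_Un)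
    then obtain a where a: "a \<in> A" "a \<inter> (F \<union> F') = d \<inter> (F \<union> F')"
      using DA d unfolding fin_closure_def by blast
    \<comment> \<open>The only candidate in \<open>D\<close> agreeing with \<open>a\<close> on
      \<open>F'\<close> is \<open>d\<close>. Adding \<open>a \<union> d\<close> to the window
      separates \<open>a\<close> from \<open>d\<close> unless they are equal, so the approximating
      point \<open>a\<close> survives in \<open>B\<close>.\<close>
    have "a \<union> d \<in> Fpow I" using a(1) d A D by (simp add: Fpow_Un subset_iff)
    then have K: "F' \<union> (a \<union> d) \<in> Fpow I" using F' by (simp add: Fpow_Un)
    have "\<forall>e\<in>D. e \<inter> (F' \<union> (a \<union> d)) = a \<inter> (F' \<union> (a \<union> d)) \<longrightarrow> e = a"
    proof (intro ballI impI)
      fix e assume e: "e \<in> D" "e \<inter> (F' \<union> (a \<union> d)) = a \<inter> (F' \<union> (a \<union> d))"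
      then have "e \<inter> F' = d \<inter> F'" using a(2) by (simp add: Int_cut)
      then have "e = d" using F' e by blast
      then show "e = a" using e(2) by blast
    qed
    then have "a \<in> B" using a K unfolding B_def by blast
    then show "\<exists>a\<in>B. a \<inter> F = d \<inter> F" using a(2) by (auto simp: Int_cut)
  qed
  have "\<exists>H. H \<in> Fpow I \<and> b \<subseteq> H \<and> (\<forall>d\<in>D. d \<inter> H = b \<longrightarrow> d = b) \<and>
      (b \<notin> fin_closure I (B - {b}) \<longrightarrow> (\<forall>a\<in>B. a \<inter> H = b \<longrightarrow> a = b))"
    if b: "b \<in> B" for b
  proof -
    obtain F where F: "F \<in> Fpow I" "\<forall>d\<in>D. d \<inter> F = b \<inter> F \<longrightarrow> d = b"
      using b unfolding B_def by blast
    have "\<exists>F'\<in>Fpow I. b \<notin> fin_closure I (B - {b}) \<longrightarrow> (\<forall>a\<in>B. a \<inter> F' = b \<inter> F' \<longrightarrow> a = b)"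
    proof (cases "b \<in> fin_closure I (B - {b})")
      case True
      \<comment> \<open>A limit point of \<open>B\<close> needs no separation from \<open>B\<close>,
        so the empty window serves.\<close>
      then show ?thesis using empty_in_Fpow by blast
    next
      case False
      then obtain F' where "F' \<in> Fpow I" "\<not> (\<exists>a\<in>B - {b}. a \<inter> F' = b \<inter> F')"
        unfolding fin_closure_def by auto
      then show ?thesis by (intro bexI[of _ F']) auto
    qed
    then obtain F' where F': "F' \<in> Fpow I"
      "b \<notin> fin_closure I (B - {b}) \<longrightarrow> (\<forall>a\<in>B. a \<inter> F' = b \<inter> F' \<longrightarrow> a = b)"
      by (elim bexE)
    let ?H = "b \<union> F \<union> F'"
    have H: "d \<inter> F = b \<inter> F \<and> d \<inter> F' = b \<inter> F'" if "d \<inter> ?H = b" for d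
    proof -
      have "d \<inter> F = (d \<inter> ?H) \<inter> F" "d \<inter> F' = (d \<inter> ?H) \<inter> F'" by auto
      then show ?thesis unfolding that by simp
    qed
    show ?thesis
    proof (intro exI[of _ ?H] conjI impI ballI)
      show "?H \<in> Fpow I" using b BI F F' by (intro Fpow_Un) auto
      show "d = b" if "d \<in> D" "d \<inter> ?H = b" for d
        using F(2) H that by blast
      show "a = b" if "b \<notin> fin_closure I (B - {b})" "a \<in> B" "a \<inter> ?H = b" for a
        using F'(2) H[OF that(3)] that(1,2) by blast
    qed auto
  qed
  then obtain G where G: "\<And>b. b \<in> B \<Longrightarrow> G b \<in> Fpow I \<and> b \<subseteq> G b \<and> (\<forall>d\<in>D. d \<inter> G b = b \<longrightarrow> d = b) \<and>
      (b \<notin> fin_closure I (B - {b}) \<longrightarrow> (\<forall>a\<in>B. a \<inter> G b = b \<longrightarrow> a = b))"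
    by metis
  define P where "P = {p \<in> Fpow B. isolating G p}"
  define le where "le = (\<lambda>p q :: 'i set set. q \<subseteq> p)"
  \<comment> \<open>The conditions that already contain a point agreeing with \<open>d\<close> on
    \<open>F\<close>. Meeting these for all \<open>F\<close> puts \<open>d\<close> in the closure of
    the generic union.\<close>
  define dns where "dns = (\<lambda>(d, F). {p\<in>P. \<exists>a\<in>p. a \<inter> F = d \<inter> F})"
  define \<D> where "\<D> = dns ` (D \<times> Fpow I)"
  have infI: "infinite I"
  proof -
    have "ordLess2 (card_of (UNIV :: nat set)) (card_of I)"
      using I unfolding aleph1_def
      by (meson card_of_Card_order cardSuc_greater ordIso_symmetric ordLess_ordIso_trans)
    then show ?thesis
      by (simp add: infinite_iff_card_of_nat ordLess_imp_ordLeq)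
  qed
  \<comment> \<open>Conditions are finite sets of finite subsets of \<open>I\<close>, and the dense
    sets are indexed by pairs of such subsets. Hence both families have size at most that of
    \<open>I\<close>.\<close>
  have cFI: "ordLeq3 (card_of (Fpow I)) (card_of I)"
    by (rule card_of_Fpow_ordLeq[OF infI])
  have "ordLeq3 (card_of P) (card_of (Fpow (Fpow I)))"
    using BI by (intro card_of_mono1) (auto simp: P_def Fpow_def)
  moreover have infF: "infinite (Fpow I)"
  proof
    assume "finite (Fpow I)"
    moreover have "(\<lambda>i. {i}) ` I \<subseteq> Fpow I" by (auto simp: Fpow_def)
    ultimately have "finite ((\<lambda>i. {i}) ` I)" using finite_subset by blast
    then show False using infI by (auto dest: finite_imageD simp: inj_on_def)
  qed
  ultimately have "ordLeq3 (card_of P) (card_of I)"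
    using card_of_Fpow_ordLeq[OF infF] cFI by (meson ordLeq_transitive)
  then have cP: "ordLeq3 (card_of P) (card_of (UNIV :: 'i set))"
    using card_of_mono1[OF subset_UNIV] ordLeq_transitive by blast
  have "ordLeq3 (card_of \<D>) (card_of (Fpow I \<times> Fpow I))"
    unfolding \<D>_def using D
    by (intro ordLeq_transitive[OF card_of_image] card_of_mono1) auto
  moreover have "ordIso2 (card_of (Fpow I \<times> Fpow I)) (card_of (Fpow I))"
    using infF by (rule card_of_Times_same_infinite)
  ultimately have cD: "ordLeq3 (card_of \<D>) aleph1"
    using cFI I by (meson ordIso_imp_ordLeq ordLeq_transitive)
  have po: "poset_on P le" by (auto simp: poset_on_def le_def)
  have ne: "P \<noteq> {}" by (auto simp: P_def isolating_def Fpow_def)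
  have ccc: "ccc P le" unfolding P_def le_def
    by (rule ccc_isolating) (use G in \<open>auto simp: Fpow_def\<close>)
  have dense: "dense_in P le (dns (d, F))" if d: "d \<in> D" and F: "F \<in> Fpow I" for d F
    unfolding dense_in_def
  proof (intro conjI ballI)
    show "dns (d, F) \<subseteq> P" by (auto simp: dns_def)
    fix p assume p: "p \<in> P"
    then have pB: "finite p" "p \<subseteq> B" "isolating G p" by (auto simp: P_def Fpow_def)
    \<comment> \<open>Adding \<open>b\<close> to \<open>p\<close> creates only two kinds of new
      pairs: \<open>b\<close> seen through an old window, and an old point seen through the window
      of \<open>b\<close>.\<close>
    have ext: "\<exists>q\<in>dns (d, F). le q p"
      if "b \<in> B" "b \<inter> F = d \<inter> F" "\<And>a. a \<in> p \<Longrightarrow> b \<inter> G a = a \<Longrightarrow> b = a"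
        "\<And>a. a \<in> p \<Longrightarrow> a \<inter> G b = b \<Longrightarrow> a = b" for b
    proof
      show "le (insert b p) p" by (auto simp: le_def)
      have "isolating G (insert b p)"
        using pB(3) that(3,4) unfolding isolating_def by blast
      then show "insert b p \<in> dns (d, F)"
        using pB that(1,2) by (auto simp: dns_def P_def Fpow_def)
    qed
    show "\<exists>q\<in>dns (d, F). le q p"
    proof (cases "d \<in> p")
      case True
      then show ?thesis using p by (intro bexI[of _ p]) (auto simp: dns_def le_def)
    next
      case dp: False
      show ?thesis
      proof (cases "d \<in> fin_closure I (B - {d})")
        case True
        \<comment> \<open>Agreement on this set makes \<open>b\<close> approximate \<open>d\<close>
          on \<open>F\<close>, contain \<open>d\<close>, meet each old point as \<open>d\<close>
          does, and look like \<open>d\<close> through every old window.\<close>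
        let ?F = "F \<union> d \<union> \<Union>p \<union> \<Union>(G ` p)"
        have pI: "\<And>a. a \<in> p \<Longrightarrow> a \<in> Fpow I \<and> G a \<in> Fpow I" using pB BI G by blast
        have "finite ?F" using F pI pB(1) d D by (auto simp: Fpow_def)
        moreover have "?F \<subseteq> I" using F pI d D unfolding Fpow_def by blast
        ultimately have "?F \<in> Fpow I" by (simp add: Fpow_def)
        then obtain b where b: "b \<in> B" "b \<noteq> d" "b \<inter> ?F = d \<inter> ?F"
          using True unfolding fin_closure_def by blast
        show ?thesis
        proof (rule ext[OF b(1)])
          show "b \<inter> F = d \<inter> F" using b(3) by blast
          fix a assume a: "a \<in> p"
          have eqs: "b \<inter> G a = d \<inter> G a" "b \<inter> a = d \<inter> a" using a b(3) by blast+
          show "b = a" if "b \<inter> G a = a"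
          proof -
            have "d \<inter> G a = a" using eqs that by simp
            \<comment> \<open>The window of \<open>a\<close> contains no point of \<open>D\<close>
              other than possibly \<open>a\<close>.\<close>
            then have "d = a" using G[of a] a pB(2) d by blast
            then show ?thesis using a dp by simp
          qed
          show "a = b" if "a \<inter> G b = b"
          proof -
            \<comment> \<open>Nothing is known about the window \<open>G b\<close>, but
              \<open>b \<subseteq> a\<close> suffices: then
              \<open>b = b \<inter> a = d \<inter> a \<subseteq> d\<close>, and
              \<open>d \<subseteq> b\<close> forces the excluded case \<open>b = d\<close>.\<close>
            have "b \<subseteq> a" using that by blast
            then have "b \<subseteq> d" using eqs by blast
            moreover have "d \<subseteq> b" using b(3) by blast
            ultimately show ?thesis using b(2) by blast
          qed
        qed
      next
        case False
        \<comment> \<open>A point of the closure of \<open>B\<close> that is not a limit of other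
          points of \<open>B\<close> must belong to \<open>B\<close>.\<close>
        have dB: "d \<in> B"
        proof (rule ccontr)
          assume "d \<notin> B"
          then have "B - {d} = B" by blast
          then show False using DB d False by auto
        qed
        show ?thesis
        proof (rule ext[OF dB refl])
          \<comment> \<open>Old windows exclude \<open>d\<close> because it lies in
            \<open>D\<close>; the window of \<open>d\<close> excludes old points because
            \<open>d\<close> is isolated in \<open>B\<close>.\<close>
          fix a assume a: "a \<in> p"
          then have aB: "a \<in> B" using pB(2) by blast
          show "d = a" if "d \<inter> G a = a" using G[OF aB] d that by blast
          show "a = d" if "a \<inter> G d = d" using G[OF dB] False aB that by blast
        qed
      qed
    qed
  qed
  then have "\<And>X. X \<in> \<D> \<Longrightarrow> dense_in P le X" by (auto simp: \<D>_def)
  then obtain H where H: "filter_in P le H" "\<And>X. X \<in> \<D> \<Longrightarrow> H \<inter> X \<noteq> {}"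
    using MA_aleph1_transfer[OF MA cP ne po ccc cD] by blast
  have HP: "H \<subseteq> P" using H by (auto simp: filter_in_def)
  have "\<Union>H \<subseteq> A" using HP by (auto simp: P_def Fpow_def B_def)
  moreover have "fin_discrete I (\<Union>H)"
    unfolding fin_discrete_def
  proof
    fix d assume "d \<in> \<Union>H"
    then obtain p where p: "p \<in> H" "d \<in> p" by blast
    then have dB: "d \<in> B" using HP by (auto simp: P_def Fpow_def)
    have "e = d" if e: "e \<in> \<Union>H" "e \<inter> G d = d \<inter> G d" for e
    proof -
      obtain q where q: "q \<in> H" "e \<in> q" using e(1) by blast
      \<comment> \<open>Directedness puts any two points of the union into one condition, so the
        fixed window \<open>G d\<close> isolates \<open>d\<close> in the whole union.\<close>
      moreover have "\<forall>p\<in>H. \<forall>q\<in>H. \<exists>r\<in>H. p \<subseteq> r \<and> q \<subseteq> r"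
        using H(1) by (simp add: filter_in_def le_def)
      ultimately obtain r where r: "r \<in> H" "p \<subseteq> r" "q \<subseteq> r"
        using p(1) by meson
      then have "isolating G r" using HP by (auto simp: P_def)
      moreover have "e \<inter> G d = d" using e(2) G[OF dB] by blast
      ultimately show ?thesis using p q r unfolding isolating_def by blast
    qed
    then show "\<exists>F\<in>Fpow I. \<forall>e\<in>\<Union>H. e \<inter> F = d \<inter> F \<longrightarrow> e = d"
      using G[OF dB] by (intro bexI[of _ "G d"]) simp_all
  qed
  moreover have "D \<subseteq> fin_closure I (\<Union>H)"
    unfolding fin_closure_def
  proof (intro subsetI CollectI ballI)
    fix d F assume "d \<in> D" "F \<in> Fpow I"
    then have "H \<inter> dns (d, F) \<noteq> {}" using H(2) by (auto simp: \<D>_def)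
    then show "\<exists>a\<in>\<Union>H. a \<inter> F = d \<inter> F" by (auto simp: dns_def)
  qed
  ultimately show ?thesis by (rule that)
qed

section \<open>Translation between the subspace of the Cantor cube and finite supports\<close>

definition supp_on :: "'i set \<Rightarrow> ('i \<Rightarrow> nat) \<Rightarrow> 'i set" where
  "supp_on I x = {i\<in>I. x i = 1}"

abbreviation sigma_space :: "'i set \<Rightarrow> ('i \<Rightarrow> nat) topology" where
  "sigma_space I \<equiv> subtopology (cantor_cube I) (sigma_cantor I)"

lemma topspace_cantor_cube: "topspace (cantor_cube I) = (\<Pi>\<^sub>E i\<in>I. {0, 1})"
  by (simp add: cantor_cube_def)

lemma topspace_sigma_space: "topspace (sigma_space I) = sigma_cantor I"
  by (auto simp: sigma_cantor_def)

lemma supp_on_Fpow: "x \<in> sigma_cantor I \<Longrightarrow> supp_on I x \<in> Fpow I"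
  by (auto simp: sigma_cantor_def supp_on_def Fpow_def)

text \<open>Points take only the values 0 and 1 on \<open>I\<close> and are extensional outside it,
  so the set of ones determines them.\<close>

lemma supp_on_inj:
  assumes "x \<in> sigma_cantor I" "y \<in> sigma_cantor I" "supp_on I x = supp_on I y"
  shows "x = y"
proof (rule PiE_ext)
  show x: "x \<in> (\<Pi>\<^sub>E i\<in>I. {0, 1})" and y: "y \<in> (\<Pi>\<^sub>E i\<in>I. {0, 1})"
    using assms by (auto simp: sigma_cantor_def topspace_cantor_cube)
  show "x i = y i" if "i \<in> I" for i
    using x y that assms(3) by (auto simp: supp_on_def PiE_iff set_eq_iff) metis
qed

text \<open>Basic neighbourhoods are phrased through supports, to match \<open>fin_discrete\<close>
  and \<open>fin_closure\<close>; \<open>cyl_eq\<close> recovers the coordinate form.\<close>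

definition cyl :: "'i set \<Rightarrow> ('i \<Rightarrow> nat) \<Rightarrow> 'i set \<Rightarrow> ('i \<Rightarrow> nat) set" where
  "cyl I x F = {y\<in>sigma_cantor I. supp_on I y \<inter> F = supp_on I x \<inter> F}"

lemma cyl_eq:
  assumes "x \<in> sigma_cantor I" "F \<subseteq> I"
  shows "cyl I x F = {y\<in>sigma_cantor I. \<forall>i\<in>F. y i = x i}"
proof -
  have "y i = x i \<longleftrightarrow> (i \<in> supp_on I y \<longleftrightarrow> i \<in> supp_on I x)" if "y \<in> sigma_cantor I" "i \<in> F" for y i
  proof -
    have "i \<in> I" using assms that by auto
    moreover have "x i \<in> {0, 1}" "y i \<in> {0, 1}"
      using assms that \<open>i \<in> I\<close> by (auto simp: sigma_cantor_def topspace_cantor_cube)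
    ultimately show ?thesis by (auto simp: supp_on_def)
  qed
  then show ?thesis by (auto simp: cyl_def)
qed

lemma openin_cyl:
  assumes x: "x \<in> sigma_cantor I" and F: "F \<in> Fpow I"
  shows "openin (sigma_space I) (cyl I x F)"
proof -
  let ?U = "\<lambda>i. if i \<in> F then {x i} else {0, 1}"
  have xE: "x \<in> (\<Pi>\<^sub>E i\<in>I. {0, 1})" using x by (simp add: sigma_cantor_def topspace_cantor_cube)
  have F': "F \<subseteq> I" "finite F" using F by (auto simp: Fpow_def)
  have "openin (cantor_cube I) (Pi\<^sub>E I ?U)"
    unfolding cantor_cube_def openin_PiE_gen
    using xE F' by (auto simp: PiE_iff intro: finite_subset[of _ F])
  moreover have "cyl I x F = Pi\<^sub>E I ?U \<inter> sigma_cantor I"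
    unfolding cyl_eq[OF x F'(1)] using F'
    by (auto simp: sigma_cantor_def topspace_cantor_cube PiE_iff extensional_def split: if_splits)
  ultimately show ?thesis by (auto simp: openin_subtopology)
qed

text \<open>A basic open box restricts only finitely many coordinates, and these form the required
  window. With \<open>openin_cyl\<close>, cylinders are thus a neighbourhood base.\<close>

lemma openin_sigma_space_cyl:
  assumes U: "openin (sigma_space I) U" "x \<in> U"
  obtains F where "F \<in> Fpow I" "cyl I x F \<subseteq> U"
proof -
  obtain V where V: "openin (cantor_cube I) V" "U = V \<inter> sigma_cantor I"
    using U by (auto simp: openin_subtopology)
  then have xs: "x \<in> V" "x \<in> sigma_cantor I" using U by auto
  from V(1) xs(1) obtain W where W: "finite {i \<in> I. W i \<noteq> {0, 1}}" "x \<in> Pi\<^sub>E I W" "Pi\<^sub>E I W \<subseteq> V"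
    unfolding cantor_cube_def openin_product_topology_alt by auto
  define F where "F = {i \<in> I. W i \<noteq> {0, 1}}"
  have F: "F \<subseteq> I" by (auto simp: F_def)
  have "y \<in> Pi\<^sub>E I W" if "y \<in> cyl I x F" for y
  proof -
    have y: "y \<in> sigma_cantor I" "\<forall>i\<in>F. y i = x i" using that by (auto simp: cyl_eq[OF xs(2) F])
    have "y i \<in> W i" if "i \<in> I" for i
    proof (cases "i \<in> F")
      case True
      then show ?thesis using y W(2) that by auto
    next
      case False
      then have "W i = {0, 1}" using that by (simp add: F_def)
      then show ?thesis using y(1) that by (auto simp: sigma_cantor_def topspace_cantor_cube)
    qed
    then show ?thesis using y(1) by (auto simp: sigma_cantor_def topspace_cantor_cube PiE_iff)
  qed
  then have "cyl I x F \<subseteq> U" using W(3) V(2) unfolding cyl_def by blast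
  moreover have "F \<in> Fpow I" using W(1) F by (simp add: Fpow_def F_def)
  ultimately show ?thesis using that by blast
qed

lemma mem_cyl_self: "x \<in> sigma_cantor I \<Longrightarrow> x \<in> cyl I x F"
  by (simp add: cyl_def)

lemma discrete_in_sigma_space_iff:
  assumes D: "D \<subseteq> sigma_cantor I"
  shows "discrete_in (sigma_space I) D \<longleftrightarrow> fin_discrete I (supp_on I ` D)"
proof -
  have "(\<exists>U. openin (sigma_space I) U \<and> U \<inter> D = {d}) \<longleftrightarrow>
      (\<exists>F\<in>Fpow I. \<forall>e\<in>D. supp_on I e \<inter> F = supp_on I d \<inter> F \<longrightarrow> supp_on I e = supp_on I d)"
    (is "?L \<longleftrightarrow> ?R") if d: "d \<in> D" for d
  proof
    assume ?L
    then obtain U where U: "openin (sigma_space I) U" "U \<inter> D = {d}" by blast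
    then obtain F where F: "F \<in> Fpow I" "cyl I d F \<subseteq> U"
      using openin_sigma_space_cyl[of I U d] by blast
    have "e = d" if "e \<in> D" "supp_on I e \<inter> F = supp_on I d \<inter> F" for e
    proof -
      have "e \<in> cyl I d F" using that D by (auto simp: cyl_def)
      then show ?thesis using F(2) U(2) that(1) by blast
    qed
    then show ?R using F(1) by blast
  next
    assume ?R
    then obtain F where F: "F \<in> Fpow I" "\<forall>e\<in>D. supp_on I e \<inter> F = supp_on I d \<inter> F \<longrightarrow> supp_on I e = supp_on I d"
      by blast
    have ds: "d \<in> sigma_cantor I" using D d by blast
    \<comment> \<open>Equality of supports is turned into equality of points by injectivity.\<close>
    have "e = d" if "e \<in> cyl I d F" "e \<in> D" for e
      using F(2) that supp_on_inj[OF _ ds, of e] by (simp add: cyl_def)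
    then have "cyl I d F \<inter> D = {d}" using d mem_cyl_self[OF ds] by blast
    then show ?L using openin_cyl[OF ds F(1)] by blast
  qed
  then show ?thesis using D
    unfolding discrete_in_def fin_discrete_def topspace_sigma_space by simp
qed

lemma closure_of_sigma_space_iff:
  assumes A: "A \<subseteq> sigma_cantor I" and x: "x \<in> sigma_cantor I"
  shows "x \<in> sigma_space I closure_of A \<longleftrightarrow> supp_on I x \<in> fin_closure I (supp_on I ` A)"
proof
  assume L: "x \<in> sigma_space I closure_of A"
  have "\<exists>a\<in>A. supp_on I a \<inter> F = supp_on I x \<inter> F" if "F \<in> Fpow I" for F
    using L openin_cyl[OF x that] mem_cyl_self[OF x] unfolding in_closure_of cyl_def by blast
  then show "supp_on I x \<in> fin_closure I (supp_on I ` A)" by (simp add: fin_closure_def)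
next
  assume R: "supp_on I x \<in> fin_closure I (supp_on I ` A)"
  have "\<exists>y\<in>A. y \<in> T" if T: "openin (sigma_space I) T" "x \<in> T" for T
  proof -
    obtain F where F: "F \<in> Fpow I" "cyl I x F \<subseteq> T" by (rule openin_sigma_space_cyl[OF T])
    then obtain a where "a \<in> A" "supp_on I a \<inter> F = supp_on I x \<inter> F"
      using R by (auto simp: fin_closure_def)
    then show ?thesis using F A by (auto simp: cyl_def)
  qed
  then show "x \<in> sigma_space I closure_of A"
    unfolding in_closure_of topspace_sigma_space using x by blast
qed

theorem theorem6p9:
  fixes I :: "'i set"
  assumes "ordIso2 (card_of I) aleph1"
    and "MA_aleph1 TYPE('i)"
  shows "DDG (subtopology (cantor_cube I) (sigma_cantor I))"
  unfolding DDG_def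
proof (intro allI impI, elim conjE)
  fix A D
  assume A: "A \<subseteq> topspace (sigma_space I)" and D: "discrete_in (sigma_space I) D"
    and DA: "D \<subseteq> sigma_space I closure_of A"
  have As: "A \<subseteq> sigma_cantor I" using A by (simp only: topspace_sigma_space)
  have Ds: "D \<subseteq> sigma_cantor I"
    using D unfolding discrete_in_def by (simp only: topspace_sigma_space)
  obtain E' where E': "E' \<subseteq> supp_on I ` A" "fin_discrete I E'" "supp_on I ` D \<subseteq> fin_closure I E'"
  proof (rule fin_DDG[OF assms])
    show "supp_on I ` A \<subseteq> Fpow I" "supp_on I ` D \<subseteq> Fpow I"
      using As Ds supp_on_Fpow by blast+
    show "fin_discrete I (supp_on I ` D)"
      using D discrete_in_sigma_space_iff[OF Ds] by simp
    show "supp_on I ` D \<subseteq> fin_closure I (supp_on I ` A)"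
      using DA Ds closure_of_sigma_space_iff[OF As] by blast
  qed
  then obtain E where E: "E \<subseteq> A" "E' = supp_on I ` E" by (auto simp: subset_image_iff)
  have Es: "E \<subseteq> sigma_cantor I" using E As by blast
  show "\<exists>E. E \<subseteq> A \<and> discrete_in (sigma_space I) E \<and> D \<subseteq> sigma_space I closure_of E"
    using E E' Ds discrete_in_sigma_space_iff[OF Es] closure_of_sigma_space_iff[OF Es]
    by (intro exI[of _ E]) blast
qed

end
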